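(* Let $\alpha\in(0,1]$, let $Z$ be a Banach space, $A\in C(\mathbb{R}_+,\mathcal{B}(Z))$ and $B\in C_b(\mathbb{R}_+,\mathcal{B}(Z))$. Assume that $\mathcal{T}^\alpha x=A(t)x$ is nonuniformly asymptotically stable in $\mathbb{R}_+$, i.e. its evolution operator $T(t,s)$ satisfies, for some constants $\hat N,\hat\beta>0$ and $\epsilon\ge0$, $$\|T(t,s)\|\le\hat N\frac{E_\alpha(\hat\beta,s)}{E_\alpha(\hat\beta,t)}E_\alpha(\epsilon,s),\qquad t\ge s,\ t,s\in\mathbb{R}_+,$$ and that there is a constant $\delta$ with $\|B(t)\|\le\delta/E_\alpha(\epsilon,t)$ for $t\in\mathbb{R}_+$. If $\theta:=\delta\hat N/\hat\beta<1$, then $\mathcal{T}^\alpha x=[A(t)+B(t)]x$ is also nonuniformly asymptotically stable in $\mathbb{R}_+$, that is, its evolution operator $U(t,s)$ satisfies $$\|U(t,s)\|\le\frac{\hat N}{1-\theta}\frac{E_\alpha(\gamma,s)}{E_\alpha(\gamma,t)}E_\alpha(\epsilon,s),\qquad t\ge s,\ t,s\in\mathbb{R}_+,$$ where $\gamma=\hat\beta-\dfrac{\delta\hat N}{1-\theta}$.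
   Context: $\mathbb{R}_+=[0,\infty)$. $\mathcal{B}(Z)$ is the Banach space of bounded linear operators on $Z$ with the operator norm; $C_b$ denotes bounded continuous functions. For $\alpha\in(0,1]$, $\mathcal{T}^\alpha g(t):=\lim_{\varepsilon\to0}\frac{g(t+\varepsilon|t|^{1-\alpha})-g(t)}{\varepsilon}$ (so $\mathcal{T}^\alpha g(t)=|t|^{1-\alpha}g'(t)$ for $t\ne0$), with $\mathcal{T}^\alpha g(0):=\lim_{t\to0}\mathcal{T}^\alpha g(t)$ if this limit exists; solutions are continuous functions satisfying the equation. $E_\alpha(\lambda,t):=\exp(\lambda t^\alpha/\alpha)$ for $t\ge0$. The evolution operators $T(t,s)$ of a linear equation are the bounded linear operators with $x(t)=T(t,s)x(s)$ for every solution $x$; they satisfy $T(t,t)=\mathrm{Id}$, $T(t,s)T(s,\tau)=T(t,\tau)$, and $T(t,s)^{-1}=T(s,t)$. *)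

theory Defs
  imports "HOL-Analysis.Analysis"
begin

text \<open>
  The conformable derivative of order \<open>\<alpha>\<close> of a function \<open>g\<close> with domain \<open>S\<close>.
  Away from \<open>0\<close> it is the limit of the difference quotients with increment
  \<open>\<epsilon> |t|^(1 - \<alpha>)\<close>.  At \<open>0\<close> it is the limit of the derivatives at nearby points of \<open>S\<close>;
  the function \<open>h\<close> below is the derivative near \<open>0\<close>, which has to exist there.
\<close>

definition has_conformable_derivative_nz ::
    "real \<Rightarrow> real set \<Rightarrow> (real \<Rightarrow> 'z::real_normed_vector) \<Rightarrow> 'z \<Rightarrow> real \<Rightarrow> bool" where
  "has_conformable_derivative_nz \<alpha> S g d t \<longleftrightarrow>
     ((\<lambda>e. (g (t + e * \<bar>t\<bar> powr (1 - \<alpha>)) - g t) /\<^sub>R e) \<longlongrightarrow> d)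
       (at 0 within {e. t + e * \<bar>t\<bar> powr (1 - \<alpha>) \<in> S})"

definition has_conformable_derivative ::
    "real \<Rightarrow> real set \<Rightarrow> (real \<Rightarrow> 'z::real_normed_vector) \<Rightarrow> 'z \<Rightarrow> real \<Rightarrow> bool" where
  "has_conformable_derivative \<alpha> S g d t \<longleftrightarrow>
     (if t \<noteq> 0 then has_conformable_derivative_nz \<alpha> S g d t
      else \<exists>h. (\<forall>\<^sub>F u in at 0 within S. has_conformable_derivative_nz \<alpha> S g (h u) u) \<and>
               (h \<longlongrightarrow> d) (at 0 within S))"

definition conformable_exp :: "real \<Rightarrow> real \<Rightarrow> real \<Rightarrow> real" where
  "conformable_exp \<alpha> c t = exp (c * t powr \<alpha> / \<alpha>)"

definition conformable_solution ::
    "real \<Rightarrow> (real \<Rightarrow> 'z::real_normed_vector \<Rightarrow>\<^sub>L 'z) \<Rightarrow> (real \<Rightarrow> 'z) \<Rightarrow> bool" where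
  "conformable_solution \<alpha> A x \<longleftrightarrow>
     continuous_on {0..} x \<and>
     (\<forall>t\<ge>0. has_conformable_derivative \<alpha> {0..} x (blinfun_apply (A t) (x t)) t)"

text \<open>
  For continuous \<open>A\<close> on a Banach space every initial value at every time \<open>s \<ge> 0\<close> is attained
  by a solution, so this condition determines \<open>T t s\<close> for all \<open>t, s \<ge> 0\<close>; the identity and
  cocycle laws are consequences.
\<close>

definition evolution_operator ::
    "real \<Rightarrow> (real \<Rightarrow> 'z::real_normed_vector \<Rightarrow>\<^sub>L 'z) \<Rightarrow> (real \<Rightarrow> real \<Rightarrow> 'z \<Rightarrow>\<^sub>L 'z) \<Rightarrow> bool" where
  "evolution_operator \<alpha> A T \<longleftrightarrow>
     (\<forall>x. conformable_solution \<alpha> A x \<longrightarrow>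
        (\<forall>t\<ge>0. \<forall>s\<ge>0. x t = blinfun_apply (T t s) (x s)))"

definition nonuniform_bound ::
    "real \<Rightarrow> (real \<Rightarrow> real \<Rightarrow> 'z::real_normed_vector \<Rightarrow>\<^sub>L 'z) \<Rightarrow> real \<Rightarrow> real \<Rightarrow> real \<Rightarrow> bool" where
  "nonuniform_bound \<alpha> T N \<beta> \<epsilon> \<longleftrightarrow>
     (\<forall>t s. 0 \<le> s \<and> s \<le> t \<longrightarrow>
        norm (T t s) \<le>
          N * (conformable_exp \<alpha> \<beta> s / conformable_exp \<alpha> \<beta> t) * conformable_exp \<alpha> \<epsilon> s)"

definition nonuniformly_asymptotically_stable ::
    "real \<Rightarrow> (real \<Rightarrow> 'z::real_normed_vector \<Rightarrow>\<^sub>L 'z) \<Rightarrow> bool" where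
  "nonuniformly_asymptotically_stable \<alpha> A \<longleftrightarrow>
     (\<exists>T N \<beta> \<epsilon>. evolution_operator \<alpha> A T \<and> N > 0 \<and> \<beta> > 0 \<and> \<epsilon> \<ge> 0 \<and> nonuniform_bound \<alpha> T N \<beta> \<epsilon>)"

end

theory Submission
  imports Defs
begin

text \<open>
  The substitution \<open>\<tau> = t\<^sup>\<alpha> / \<alpha>\<close> turns the conformable equation into an ordinary linear equation
  \<open>y' = L(\<tau>) y\<close> and \<open>E\<^sub>\<alpha>(c, t)\<close> into \<open>exp(c \<tau>)\<close>.  Picard iteration gives a fundamental
  solution \<open>\<Phi>\<close> and a solution \<open>\<Psi>\<close> of the adjoint equation with \<open>\<Phi> \<Psi> = id\<close>; then
  \<open>\<Phi>(\<tau>) \<Psi>(\<sigma>)\<close> is the evolution operator.  By variation of constants a solution \<open>y\<close> of the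
  perturbed equation satisfies
  \<open>y(\<tau>) = \<Phi>(\<tau>) \<Psi>(\<sigma>) y(\<sigma>) + \<integral> \<Phi>(\<tau>) \<Psi>(r) B(r) y(r) dr\<close>, where the decay of \<open>B\<close> cancels the
  nonuniform factor \<open>exp(\<epsilon> r)\<close>.  Gronwall's inequality for \<open>exp(\<beta> r) \<parallel>y(r)\<parallel>\<close> then yields the
  bound with constant \<open>N\<close> and rate \<open>\<beta> - \<delta> N > 0\<close>.  This gives stability, and also the stated
  bound because \<open>N \<le> N / (1 - \<theta>)\<close> and \<open>\<gamma> \<le> \<beta> - \<delta> N\<close>; the rate \<open>\<gamma>\<close> itself may be negative.
\<close>

section \<open>Continuity on half-lines, Gronwall's inequality and uniqueness\<close>

text \<open>Continuity is local: near \<open>t\<close> the half-line coincides with the segment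
  \<open>{a..t+1}\<close>. This glues results obtained on compact segments.\<close>

lemma continuous_on_atLeast:
  fixes f :: "real \<Rightarrow> 'a::topological_space"
  assumes "\<And>b. a \<le> b \<Longrightarrow> continuous_on {a..b} f"
  shows "continuous_on {a..} f"
  unfolding continuous_on_eq_continuous_within
proof
  fix t assume "t \<in> {a..}"
  then have "continuous (at t within {a..t+1}) f"
    using assms[of "t+1"] by (auto simp: continuous_on_eq_continuous_within)
  moreover have "at t within {a..} = at t within {a..t+1}"
    by (rule at_within_nhd[of _ "{..<t+1}"]) auto
  ultimately show "continuous (at t within {a..}) f" by simp
qed

lemma bounded_on_segment:
  fixes L :: "real \<Rightarrow> 'a::real_normed_vector"
  assumes "continuous_on {0..} L"
  obtains M where "M > 0" "\<And>t. t \<in> {0..b} \<Longrightarrow> norm (L t) \<le> M"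
proof -
  have "bounded (L ` {0..b})"
    by (intro compact_imp_bounded compact_continuous_image continuous_on_subset[OF assms]) auto
  then show thesis
    using that unfolding bounded_pos by auto
qed

text \<open>With the integrating factor \<open>exp (- K * (t - a))\<close>, the right-hand side of
  the integral inequality becomes the function \<open>w\<close>. Its derivative is a nonnegative
  multiple of \<open>u x - (c + K * integral {a..x} u)\<close>, so \<open>w\<close> never exceeds
  its initial value \<open>c\<close>.\<close>

lemma gronwall:
  fixes u :: "real \<Rightarrow> real"
  assumes cont: "continuous_on {a..b} u" and K: "K \<ge> 0" and t: "t \<in> {a..b}"
    and le: "\<And>t. t \<in> {a..b} \<Longrightarrow> u t \<le> c + K * integral {a..t} u"
  shows "u t \<le> c * exp (K * (t - a))"
proof -
  define w where "w = (\<lambda>t. (c + K * integral {a..t} u) * exp (- K * (t - a)))"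
  have "w t \<le> w a"
  proof (rule DERIV_nonpos_imp_decreasing_open[of a t w])
    show "a \<le> t" using t by auto
    show "continuous_on {a..t} w" unfolding w_def
      using t continuous_on_subset[OF cont]
      by (auto intro!: continuous_intros indefinite_integral_continuous_1 integrable_continuous_real)
    fix x assume x: "a < x" "x < t"
    have "((\<lambda>x. integral {a..x} u) has_real_derivative u x) (at x within {a..b})"
      using x t by (intro integral_has_real_derivative cont) auto
    moreover have "at x within {a..b} = at x"
      using x t by (intro at_within_interior) auto
    ultimately have "((\<lambda>x. integral {a..x} u) has_real_derivative u x) (at x)" by simp
    then have "(w has_real_derivative
        K * (u x - (c + K * integral {a..x} u)) * exp (- K * (x - a))) (at x)"
      unfolding w_def by (auto intro!: derivative_eq_intros simp: algebra_simps)
    moreover have "K * (u x - (c + K * integral {a..x} u)) * exp (- K * (x - a)) \<le> 0"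
      using le[of x] x t K by (intro mult_nonpos_nonneg mult_nonneg_nonpos) auto
    ultimately show "\<exists>y. DERIV w x :> y \<and> y \<le> 0" by blast
  qed
  then have "c + K * integral {a..t} u \<le> c * exp (K * (t - a))"
    unfolding w_def by (simp add: exp_diff exp_minus field_simps)
  with le[OF t] show ?thesis by simp
qed

text \<open>Since \<open>y\<close> is the integral of \<open>F\<close>, Gronwall's inequality with
  initial constant 0 applies to \<open>norm (y t)\<close>. Keeping \<open>F\<close> a separate
  function covers two-sided equations such as W' = L W - W L, and \<open>F = 0\<close> gives
  constancy.\<close>

lemma linear_growth_imp_zero:
  fixes y :: "real \<Rightarrow> 'a::banach"
  assumes cont: "continuous_on {0..b} y" and zero: "y 0 = 0" and K: "K \<ge> 0"
    and contF: "continuous_on {0..b} F"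
    and deriv: "\<And>t. 0 < t \<Longrightarrow> t < b \<Longrightarrow> (y has_vector_derivative F t) (at t)"
    and le: "\<And>t. t \<in> {0..b} \<Longrightarrow> norm (F t) \<le> K * norm (y t)"
    and t: "t \<in> {0..b}"
  shows "y t = 0"
proof -
  have "norm (y t) \<le> 0 * exp (K * (t - 0))"
  proof (rule gronwall[OF _ K t])
    show "continuous_on {0..b} (\<lambda>t. norm (y t))"
      using cont by (intro continuous_intros)
    fix t assume t: "t \<in> {0..b}"
    have sub: "continuous_on {0..t} y" "continuous_on {0..t} F"
      using t by (auto intro: continuous_on_subset[OF cont] continuous_on_subset[OF contF])
    have "(F has_integral (y t - y 0)) {0..t}"
      using t sub deriv by (intro fundamental_theorem_of_calculus_interior) auto
    then have "norm (y t) = norm (integral {0..t} F)"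
      using zero by (simp add: integral_unique)
    also have "\<dots> \<le> integral {0..t} (\<lambda>r. K * norm (y r))"
      using t sub le
      by (intro integral_norm_bound_integral integrable_continuous_real continuous_intros) auto
    finally show "norm (y t) \<le> 0 + K * integral {0..t} (\<lambda>t. norm (y t))" by simp
  qed
  then show ?thesis by simp
qed

section \<open>Existence for linear equations by Picard iteration\<close>

text \<open>On each segment the series of iterated integrals of \<open>c\<close> is dominated by an
  exponential series. A general bilinear \<open>mult\<close> serves both operator equations needed
  below: composition with \<open>L\<close> on the left, and on the right through the flipped
  product.\<close>

lemma linear_ode_exists:
  fixes mult :: "'a::real_normed_vector \<Rightarrow> 'b::banach \<Rightarrow> 'b"
  assumes bil: "bounded_bilinear mult" and L: "continuous_on {0..} L"
  obtains y where "continuous_on {0..} y" "y 0 = c"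
    "\<And>t. t > 0 \<Longrightarrow> (y has_vector_derivative mult (L t) (y t)) (at t)"
proof -
  interpret bounded_bilinear mult by (rule bil)
  \<comment> \<open>\<open>Y n\<close> is the n-th term of the Picard series; the Picard iterates
    are its partial sums.\<close>
  define Y where "Y = rec_nat (\<lambda>_. c) (\<lambda>n u t. integral {0..t} (\<lambda>r. mult (L r) (u r)))"
  have Y_0: "Y 0 t = c" and Y_Suc: "Y (Suc n) t = integral {0..t} (\<lambda>r. mult (L r) (Y n r))" for n t
    by (simp_all add: Y_def)
  have contY: "continuous_on {0..} (Y n)" for n
  proof (induction n)
    case 0
    then show ?case by (simp add: Y_def)
  next
    case (Suc n)
    have "continuous_on {0..} (\<lambda>r. mult (L r) (Y n r))"
      using L Suc by (rule continuous_on)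
    then have "(\<lambda>r. mult (L r) (Y n r)) integrable_on {0..b}" for b
      by (auto intro!: integrable_continuous_real intro: continuous_on_subset)
    then show ?case
      unfolding Y_Suc[abs_def] by (intro continuous_on_atLeast indefinite_integral_continuous_1)
  qed
  define y where "y = (\<lambda>t. \<Sum>n. Y n t)"
  \<comment> \<open>\<open>L\<close> is bounded only on compact segments, so all estimates are made
    on \<open>{0..b}\<close>. The sum \<open>y\<close> does not depend on \<open>b\<close>.\<close>
  have *: "continuous_on {0..b} y \<and> (\<forall>t\<in>{0..b}. y t = c + integral {0..t} (\<lambda>r. mult (L r) (y r)))"
    if b: "b \<ge> 0" for b
  proof -
    obtain M where M: "M > 0" "\<And>t. t \<in> {0..b} \<Longrightarrow> norm (L t) \<le> M"
      using bounded_on_segment[OF L] by metis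
    obtain K0 where K0: "K0 > 0" "\<And>x z. norm (mult x z) \<le> norm x * norm z * K0"
      using pos_bounded by blast
    define K where "K = M * K0"
    have K: "norm (mult (L t) x) \<le> K * norm x" if "t \<in> {0..b}" for t x
    proof -
      have "norm (mult (L t) x) \<le> norm (L t) * norm x * K0" by (rule K0)
      also have "\<dots> \<le> M * norm x * K0"
        using that M K0 by (intro mult_right_mono) auto
      finally show ?thesis by (simp add: K_def mult_ac)
    qed
    have "K \<ge> 0" using M K0 by (simp add: K_def)
    have sub: "continuous_on {0..t} L" "continuous_on {0..t} (Y n)" for t n
      by (auto intro: continuous_on_subset[OF L] continuous_on_subset[OF contY])
    have bound: "norm (Y n t) \<le> norm c * (K * t) ^ n / fact n" if "t \<in> {0..b}" for n t
      using that
    proof (induction n arbitrary: t)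
      case 0
      then show ?case by (simp add: Y_0)
    next
      case (Suc n)
      have int: "((\<lambda>r. K * (norm c * (K * r) ^ n / fact n)) has_integral
          (norm c * (K * t) ^ Suc n / fact (Suc n) - norm c * (K * 0) ^ Suc n / fact (Suc n))) {0..t}"
      proof (rule fundamental_theorem_of_calculus)
        fix r assume "r \<in> {0..t}"
        have "((\<lambda>r. norm c * K ^ Suc n / fact (Suc n) * r ^ Suc n) has_real_derivative
            norm c * K ^ Suc n / fact (Suc n) * (real (Suc n) * r ^ n)) (at r within {0..t})"
          using DERIV_pow[of "Suc n" r "{0..t}"] by (intro DERIV_cmult) simp
        moreover have "norm c * K ^ Suc n / fact (Suc n) * (real (Suc n) * r ^ n) = K * (norm c * (K * r) ^ n / fact n)"
          unfolding fact_Suc of_nat_mult by (simp add: power_mult_distrib divide_simps del: of_nat_Suc)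
        ultimately show "((\<lambda>r. norm c * (K * r) ^ Suc n / fact (Suc n)) has_vector_derivative
            K * (norm c * (K * r) ^ n / fact n)) (at r within {0..t})"
          by (simp add: power_mult_distrib mult_ac flip: has_real_derivative_iff_has_vector_derivative del: fact_Suc)
      qed (use Suc.prems in auto)
      have "norm (Y (Suc n) t) \<le> integral {0..t} (\<lambda>r. K * (norm c * (K * r) ^ n / fact n))"
        unfolding Y_Suc
      proof (rule integral_norm_bound_integral)
        show "(\<lambda>r. mult (L r) (Y n r)) integrable_on {0..t}"
          using sub by (intro integrable_continuous_real continuous_on)
        show "(\<lambda>r. K * (norm c * (K * r) ^ n / fact n)) integrable_on {0..t}"
          using int by blast
        fix r assume "r \<in> {0..t}"
        then have "r \<in> {0..b}" using Suc.prems by auto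
        then show "norm (mult (L r) (Y n r)) \<le> K * (norm c * (K * r) ^ n / fact n)"
          using K[of r "Y n r"] mult_left_mono[OF Suc.IH[of r] \<open>K \<ge> 0\<close>] by linarith
      qed
      also have "\<dots> = norm c * (K * t) ^ Suc n / fact (Suc n)"
        by (subst integral_unique[OF int]) simp
      finally show ?case .
    qed
    have unif: "uniform_limit {0..b} (\<lambda>N t. \<Sum>n<N. Y n t) y sequentially"
      unfolding y_def
    proof (rule Weierstrass_m_test)
      show "summable (\<lambda>n. norm c * ((K * b) ^ n / fact n))"
        using summable_exp_generic[of "K * b"] by (intro summable_mult) (simp add: divide_inverse_commute)
      fix n t assume t: "t \<in> {0..b}"
      have "(K * t) ^ n \<le> (K * b) ^ n"
        using t \<open>K \<ge> 0\<close> by (intro power_mono mult_left_mono) auto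
      then have "norm c * (K * t) ^ n / fact n \<le> norm c * (K * b) ^ n / fact n"
        by (intro divide_right_mono mult_left_mono) auto
      then show "norm (Y n t) \<le> norm c * ((K * b) ^ n / fact n)"
        using bound[OF t, of n] by simp
    qed
    have conty: "continuous_on {0..b} y"
      by (rule uniform_limit_theorem[OF _ unif]) (auto intro!: always_eventually continuous_intros sub)
    have unif': "uniform_limit {0..b} (\<lambda>N t. mult (L t) (\<Sum>n<N. Y n t)) (\<lambda>t. mult (L t) (y t)) sequentially"
    proof (rule uniform_limitI)
      fix e :: real assume "e > 0"
      \<comment> \<open>The divisor \<open>K + 1\<close> is positive given only
        \<open>K \<ge> 0\<close>.\<close>
      have "\<forall>\<^sub>F N in sequentially. \<forall>t\<in>{0..b}. dist (\<Sum>n<N. Y n t) (y t) < e / (K + 1)"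
        using unif \<open>e > 0\<close> \<open>K \<ge> 0\<close> by (intro uniform_limitD) auto
      then show "\<forall>\<^sub>F N in sequentially. \<forall>t\<in>{0..b}. dist (mult (L t) (\<Sum>n<N. Y n t)) (mult (L t) (y t)) < e"
      proof eventually_elim
        case (elim N)
        show ?case
        proof
          fix t assume t: "t \<in> {0..b}"
          let ?d = "dist (\<Sum>n<N. Y n t) (y t)"
          have "dist (mult (L t) (\<Sum>n<N. Y n t)) (mult (L t) (y t)) \<le> K * ?d"
            using K[OF t] by (simp add: dist_norm flip: diff_right)
          also have "\<dots> \<le> (K + 1) * ?d" by (simp add: algebra_simps)
          also have "\<dots> < e" using elim t \<open>K \<ge> 0\<close> by (simp add: field_simps)
          finally show "dist (mult (L t) (\<Sum>n<N. Y n t)) (mult (L t) (y t)) < e" .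
        qed
      qed
    qed
    have "y t = c + integral {0..t} (\<lambda>r. mult (L r) (y r))" if t: "t \<in> {0..b}" for t
    proof -
      have u: "uniform_limit {0..t} (\<lambda>N t. mult (L t) (\<Sum>n<N. Y n t)) (\<lambda>t. mult (L t) (y t)) sequentially"
        using unif' t by (rule_tac uniform_limit_on_subset) auto
      have cont: "continuous_on {0..t} (\<lambda>t. mult (L t) (\<Sum>n<N. Y n t))" for N
        by (intro continuous_on continuous_on_sum sub)
      obtain I J where
        IJ: "\<And>N. ((\<lambda>t. mult (L t) (\<Sum>n<N. Y n t)) has_integral I N) {0..t}"
          "((\<lambda>t. mult (L t) (y t)) has_integral J) {0..t}" "I \<longlonglongrightarrow> J"
        by (rule uniform_limit_integral[OF u cont sequentially_bot]) (rule that)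
      \<comment> \<open>Index shift: splitting off \<open>Y 0 t = c\<close>, each further term is
        the integral of its predecessor. Letting N tend to infinity yields the integral
        equation.\<close>
      have "(\<Sum>n<Suc N. Y n t) = c + I N" for N
      proof -
        have "I N = integral {0..t} (\<lambda>t. mult (L t) (\<Sum>n<N. Y n t))"
          using IJ(1)[of N] by (simp add: integral_unique)
        also have "\<dots> = integral {0..t} (\<lambda>t. \<Sum>n<N. mult (L t) (Y n t))"
          by (simp add: sum_right)
        also have "\<dots> = (\<Sum>n<N. integral {0..t} (\<lambda>t. mult (L t) (Y n t)))"
          using sub by (intro integral_sum integrable_continuous_real continuous_on) auto
        finally show ?thesis
          by (simp add: sum.lessThan_Suc_shift Y_0 Y_Suc del: sum.lessThan_Suc)
      qed
      then have "(\<lambda>N. \<Sum>n<Suc N. Y n t) \<longlonglongrightarrow> c + J"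
        using IJ(3) by (auto intro!: tendsto_intros)
      moreover have "(\<lambda>N. \<Sum>n<N. Y n t) \<longlonglongrightarrow> y t"
        using tendsto_uniform_limitI[OF unif t] .
      then have "(\<lambda>N. \<Sum>n<Suc N. Y n t) \<longlonglongrightarrow> y t"
        by (rule LIMSEQ_Suc)
      ultimately have "y t = c + J" by (rule LIMSEQ_unique[rotated])
      then show ?thesis using IJ(2) by (simp add: integral_unique)
    qed
    with conty show ?thesis by blast
  qed
  show thesis
  proof
    show "continuous_on {0..} y" using * by (blast intro: continuous_on_atLeast)
    show "y 0 = c" using *[of 0] by auto
    fix t :: real assume t: "t > 0"
    \<comment> \<open>The integral equation is differentiated on a segment reaching beyond
      \<open>t\<close>, so that \<open>t\<close> is interior and the derivative is
      two-sided.\<close>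
    have "continuous_on {0..t+1} (\<lambda>r. mult (L r) (y r))"
      using *[of "t+1"] t by (auto intro!: continuous_on continuous_on_subset[OF L])
    then have "((\<lambda>t. c + integral {0..t} (\<lambda>r. mult (L r) (y r))) has_vector_derivative mult (L t) (y t))
        (at t within {0..t+1})"
      using t by (auto intro!: derivative_eq_intros integral_has_vector_derivative)
    then have "(y has_vector_derivative mult (L t) (y t)) (at t within {0..t+1})"
      by (rule has_vector_derivative_transform[rotated 2]) (use *[of "t+1"] t in auto)
    moreover have "at t within {0..t+1} = at t"
      using t by (intro at_within_interior) auto
    ultimately show "(y has_vector_derivative mult (L t) (y t)) (at t)" by simp
  qed
qed

section \<open>Fundamental solutions, their inverses and variation of constants\<close>

text \<open>
  Since \<open>\<Psi>\<close> solves the adjoint equation, \<open>\<Psi> t (y t)\<close> is constant for every solution \<open>y\<close>.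
\<close>

locale fundamental_pair =
  fixes L \<Phi> \<Psi> :: "real \<Rightarrow> 'z::banach \<Rightarrow>\<^sub>L 'z"
  assumes cont_\<Phi>: "continuous_on {0..} \<Phi>"
    and cont_\<Psi>: "continuous_on {0..} \<Psi>"
    and deriv_\<Phi>: "t > 0 \<Longrightarrow> (\<Phi> has_vector_derivative L t o\<^sub>L \<Phi> t) (at t)"
    and deriv_\<Psi>: "t > 0 \<Longrightarrow> (\<Psi> has_vector_derivative - (\<Psi> t o\<^sub>L L t)) (at t)"
    and \<Phi>_\<Psi>: "t \<ge> 0 \<Longrightarrow> \<Phi> t o\<^sub>L \<Psi> t = id_blinfun"

lemma blinfun_compose_assoc: "(f o\<^sub>L g) o\<^sub>L h = f o\<^sub>L (g o\<^sub>L h)"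
  by (rule blinfun_eqI) simp

lemma blinfun_compose_id [simp]: "f o\<^sub>L id_blinfun = f" "id_blinfun o\<^sub>L f = f"
  by (rule blinfun_eqI, simp)+

text \<open>The product \<Psi> \<Phi> has derivative zero, but in infinite dimensions a one-sided
  inverse need not be two-sided. The order \<Phi> \<Psi> used later is therefore obtained directly,
  by uniqueness for the equation that this product satisfies.\<close>

lemma fundamental_pair_exists:
  fixes L :: "real \<Rightarrow> 'z::banach \<Rightarrow>\<^sub>L 'z"
  assumes L: "continuous_on {0..} L"
  obtains \<Phi> \<Psi> where "fundamental_pair L \<Phi> \<Psi>"
proof -
  note compose = bounded_bilinear_blinfun_compose[where 'a='z and 'b='z and 'c='z]
  note compose_deriv = bounded_bilinear.has_vector_derivative[OF compose]
  obtain \<Phi> where \<Phi>: "continuous_on {0..} \<Phi>" "\<Phi> 0 = id_blinfun"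
    "\<And>t. t > 0 \<Longrightarrow> (\<Phi> has_vector_derivative L t o\<^sub>L \<Phi> t) (at t)"
    using linear_ode_exists[OF compose L, of id_blinfun] by metis
  have minus: "continuous_on {0..} (\<lambda>t. - L t)"
    using L by (rule continuous_on_minus)
  obtain \<Psi> where \<Psi>: "continuous_on {0..} \<Psi>" "\<Psi> 0 = id_blinfun"
    "\<And>t. t > 0 \<Longrightarrow> (\<Psi> has_vector_derivative \<Psi> t o\<^sub>L - L t) (at t)"
    using linear_ode_exists[OF bounded_bilinear.flip[OF compose] minus, of id_blinfun] by metis
  have \<Psi>': "(\<Psi> has_vector_derivative - (\<Psi> t o\<^sub>L L t)) (at t)" if "t > 0" for t
    using \<Psi>(3)[OF that] by (simp add: bounded_bilinear.minus_right[OF compose])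
  have cont: "continuous_on {0..b} \<Phi>" "continuous_on {0..b} \<Psi>" "continuous_on {0..b} L" for b
    by (auto intro: continuous_on_subset[OF L] continuous_on_subset[OF \<Phi>(1)] continuous_on_subset[OF \<Psi>(1)])
  have \<Phi>_\<Psi>: "\<Phi> t o\<^sub>L \<Psi> t = id_blinfun" if t: "t \<ge> 0" for t
  proof -
    obtain M where M: "M > 0" "\<And>r. r \<in> {0..t} \<Longrightarrow> norm (L r) \<le> M"
      using bounded_on_segment[OF L] by metis
    \<comment> \<open>Both \<open>\<Phi> \<Psi>\<close> and \<open>id\<close> solve \<open>W' = L W - W L\<close> with the same initial value.\<close>
    define D where "D = (\<lambda>t. (\<Phi> t o\<^sub>L \<Psi> t) - id_blinfun)"
    have "D t = 0"
    proof (rule linear_growth_imp_zero)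
      show "continuous_on {0..t} D" "D 0 = 0" "continuous_on {0..t} (\<lambda>r. (L r o\<^sub>L D r) - (D r o\<^sub>L L r))"
        using \<Phi>(2) \<Psi>(2) by (auto simp: D_def intro!: continuous_intros cont)
      show "(D has_vector_derivative (L r o\<^sub>L D r) - (D r o\<^sub>L L r)) (at r)" if "0 < r" for r
        using compose_deriv[OF \<Phi>(3)[OF that] \<Psi>'[OF that]] unfolding D_def
        by (simp add: has_vector_derivative_diff_const blinfun_compose_assoc
            bounded_bilinear.minus_right[OF compose]
            bounded_bilinear.diff_right[OF compose] bounded_bilinear.diff_left[OF compose])
      show "norm ((L r o\<^sub>L D r) - (D r o\<^sub>L L r)) \<le> (2 * M) * norm (D r)" if "r \<in> {0..t}" for r
      proof -
        have "norm ((L r o\<^sub>L D r) - (D r o\<^sub>L L r)) \<le> norm (L r) * norm (D r) + norm (D r) * norm (L r)"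
          by (intro order_trans[OF norm_triangle_ineq4] add_mono norm_blinfun_compose)
        also have "\<dots> = 2 * norm (L r) * norm (D r)" by simp
        also have "\<dots> \<le> 2 * M * norm (D r)"
          using M(2)[OF that] by (intro mult_right_mono mult_left_mono) auto
        finally show ?thesis .
      qed
    qed (use t M in auto)
    then show ?thesis by (simp add: D_def)
  qed
  show thesis
    by (rule that[of \<Phi> \<Psi>]) (unfold_locales, use \<Phi> \<Psi> \<Psi>' \<Phi>_\<Psi> in auto)
qed

context fundamental_pair
begin

lemma \<Phi>_\<Psi>_apply: "t \<ge> 0 \<Longrightarrow> \<Phi> t (\<Psi> t v) = v"
  using \<Phi>_\<Psi>[of t] by (metis blinfun_apply_blinfun_compose blinfun_apply_id_blinfun)

text \<open>Variation of constants in differential form: in the product rule the term - \<Psi> L y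
  from the adjoint equation cancels \<Psi> L y, leaving only the inhomogeneity.\<close>

lemma has_derivative_pullback:
  assumes "t > 0" "(y has_vector_derivative L t (y t) + g) (at t)"
  shows "((\<lambda>t. \<Psi> t (y t)) has_vector_derivative \<Psi> t g) (at t)"
  using bounded_bilinear.has_vector_derivative[OF bounded_bilinear_blinfun_apply deriv_\<Psi> assms(2)] assms(1)
  by (simp add: blinfun.bilinear_simps)

lemma solution:
  shows "continuous_on {0..} (\<lambda>t. \<Phi> t v)"
    and "t > 0 \<Longrightarrow> ((\<lambda>t. \<Phi> t v) has_vector_derivative L t (\<Phi> t v)) (at t)"
  using bounded_bilinear.has_vector_derivative[OF bounded_bilinear_blinfun_apply deriv_\<Phi> has_vector_derivative_const[of v]]
  by (auto intro!: continuous_intros cont_\<Phi>)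

lemma solution_unique:
  assumes cont: "continuous_on {0..} y"
    and deriv: "\<And>t. t > 0 \<Longrightarrow> (y has_vector_derivative L t (y t)) (at t)"
    and "t \<ge> 0" "s \<ge> 0"
  shows "y t = (\<Phi> t o\<^sub>L \<Psi> s) (y s)"
proof -
  have const: "\<Psi> r (y r) = \<Psi> 0 (y 0)" if "r \<ge> 0" for r
  proof -
    have "\<Psi> r (y r) - \<Psi> 0 (y 0) = 0"
    \<comment> \<open>The growth lemma with \<open>K = 0\<close> and \<open>F = 0\<close> says that
      a continuous function with zero derivative is constant.\<close>
    proof (rule linear_growth_imp_zero[of r "\<lambda>r. \<Psi> r (y r) - \<Psi> 0 (y 0)" 0 "\<lambda>_. 0"])
      show "continuous_on {0..r} (\<lambda>r. \<Psi> r (y r) - \<Psi> 0 (y 0))"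
        by (auto intro!: continuous_intros continuous_on_subset[OF cont] continuous_on_subset[OF cont_\<Psi>])
      show "((\<lambda>r. \<Psi> r (y r) - \<Psi> 0 (y 0)) has_vector_derivative 0) (at q)" if "0 < q" for q
        using has_derivative_pullback[of q y 0] deriv[of q] that
        by (simp add: has_vector_derivative_diff_const)
    qed (use that in auto)
    then show ?thesis by simp
  qed
  show ?thesis
    using const[of t] const[of s] \<Phi>_\<Psi>_apply[of t "y t"] assms by simp
qed

text \<open>The term \<open>P t (y t)\<close> is treated as an inhomogeneity of the unperturbed
  equation. The bound on \<Phi> \<Psi> loses \<open>exp (\<epsilon> * r)\<close> at each starting
  time r and \<open>P\<close> regains it, so the nonuniform factor survives only at the initial time
  \<open>s\<close>.\<close>

lemma perturbed_solution_bound: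
  fixes P :: "real \<Rightarrow> 'z \<Rightarrow>\<^sub>L 'z"
  assumes cont_P: "continuous_on {0..} P" and cont_y: "continuous_on {0..} y"
    and deriv: "\<And>t. t > 0 \<Longrightarrow> (y has_vector_derivative L t (y t) + P t (y t)) (at t)"
    and bound: "\<And>t s. 0 \<le> s \<Longrightarrow> s \<le> t \<Longrightarrow>
      norm (\<Phi> t o\<^sub>L \<Psi> s) \<le> N * exp (\<beta> * (s - t)) * exp (\<epsilon> * s)"
    and P: "\<And>t. t \<ge> 0 \<Longrightarrow> norm (P t) \<le> \<delta> * exp (- (\<epsilon> * t))"
    and N: "N \<ge> 0" and \<delta>: "\<delta> \<ge> 0" and s: "0 \<le> s" and st: "s \<le> t"
  shows "norm (y t) \<le> N * exp ((\<beta> - \<delta> * N) * (s - t)) * exp (\<epsilon> * s) * norm (y s)"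
proof -
  \<comment> \<open>\<open>C\<close> is the bound on the homogeneous term after multiplication by
    \<open>exp (\<beta> * q)\<close>, which removes the dependence on q. The same weight defines
    \<open>u\<close>.\<close>
  define C where "C = N * exp (\<beta> * s) * exp (\<epsilon> * s) * norm (y s)"
  define u where "u = (\<lambda>r. exp (\<beta> * r) * norm (y r))"
  have cont: "continuous_on {s..q} y" "continuous_on {s..q} P" "continuous_on {s..q} \<Psi>" for q
    using s by (auto intro: continuous_on_subset[OF cont_P] continuous_on_subset[OF cont_y]
        continuous_on_subset[OF cont_\<Psi>])
  have cont_u: "continuous_on {s..q} u" for q
    unfolding u_def by (intro continuous_intros cont)
  have "u t \<le> C * exp ((\<delta> * N) * (t - s))"
  proof (rule gronwall[of s t])
    fix q assume q: "q \<in> {s..t}"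
    then have "s \<le> q" by simp
    \<comment> \<open>\<open>?F\<close> is the derivative of \<Phi>(q) \<Psi>(r) y(r) in r, a
      function whose value at r = q is y(q). Integrating it from \<open>s\<close> to q is the
      variation of constants formula.\<close>
    let ?F = "\<lambda>r. \<Phi> q (\<Psi> r (P r (y r)))"
    have "(?F has_integral (\<Phi> q (\<Psi> q (y q)) - \<Phi> q (\<Psi> s (y s)))) {s..q}"
    proof (rule fundamental_theorem_of_calculus_interior[OF \<open>s \<le> q\<close>])
      show "continuous_on {s..q} (\<lambda>r. \<Phi> q (\<Psi> r (y r)))"
        by (intro continuous_intros cont)
      fix r assume "r \<in> {s<..<q}"
      then have "r > 0" using s by auto
      then show "((\<lambda>r. \<Phi> q (\<Psi> r (y r))) has_vector_derivative ?F r) (at r)"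
        by (intro bounded_linear.has_vector_derivative[OF blinfun.bounded_linear_right]
            has_derivative_pullback deriv)
    qed
    then have y_q: "y q = \<Phi> q (\<Psi> s (y s)) + integral {s..q} ?F"
      using \<Phi>_\<Psi>_apply[of q "y q"] s \<open>s \<le> q\<close> by (simp add: integral_unique)
    have "norm (\<Phi> q (\<Psi> s (y s))) \<le> norm (\<Phi> q o\<^sub>L \<Psi> s) * norm (y s)"
      using norm_blinfun[of "\<Phi> q o\<^sub>L \<Psi> s" "y s"] by simp
    also have "\<dots> \<le> exp (- (\<beta> * q)) * C"
      using mult_right_mono[OF bound[OF s \<open>s \<le> q\<close>] norm_ge_zero[of "y s"]]
      by (simp add: C_def algebra_simps exp_diff exp_minus divide_inverse)
    finally have 1: "norm (\<Phi> q (\<Psi> s (y s))) \<le> exp (- (\<beta> * q)) * C" .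
    have "norm (integral {s..q} ?F) \<le> integral {s..q} (\<lambda>r. (exp (- (\<beta> * q)) * (\<delta> * N)) * u r)"
    proof (rule integral_norm_bound_integral)
      show "?F integrable_on {s..q}"
        by (intro integrable_continuous_real continuous_intros cont)
      show "(\<lambda>r. (exp (- (\<beta> * q)) * (\<delta> * N)) * u r) integrable_on {s..q}"
        by (intro integrable_continuous_real continuous_intros cont_u)
      fix r assume r: "r \<in> {s..q}"
      then have "0 \<le> r" "r \<le> q" using s by auto
      have "norm (?F r) \<le> norm (\<Phi> q o\<^sub>L \<Psi> r) * norm (P r (y r))"
        using norm_blinfun[of "\<Phi> q o\<^sub>L \<Psi> r" "P r (y r)"] by simp
      also have "\<dots> \<le> norm (\<Phi> q o\<^sub>L \<Psi> r) * (norm (P r) * norm (y r))"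
        by (intro mult_left_mono norm_blinfun norm_ge_zero)
      also have "\<dots> \<le> (N * exp (\<beta> * (r - q)) * exp (\<epsilon> * r)) * ((\<delta> * exp (- (\<epsilon> * r))) * norm (y r))"
        using N \<delta> \<open>0 \<le> r\<close> \<open>r \<le> q\<close>
        by (intro mult_mono bound P mult_right_mono mult_nonneg_nonneg) auto
      \<comment> \<open>The two exponentials in \<epsilon> cancel, and
        \<open>exp (\<beta> * r)\<close> turns \<open>norm (y r)\<close> into
        \<open>u r\<close>.\<close>
      also have "\<dots> = (exp (- (\<beta> * q)) * (\<delta> * N)) * u r"
        by (simp add: u_def right_diff_distrib exp_diff exp_minus field_simps)
      finally show "norm (?F r) \<le> (exp (- (\<beta> * q)) * (\<delta> * N)) * u r" .
    qed
    then have "norm (integral {s..q} ?F) \<le> exp (- (\<beta> * q)) * (\<delta> * N * integral {s..q} u)"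
      by simp
    with 1 have "norm (y q) \<le> exp (- (\<beta> * q)) * (C + \<delta> * N * integral {s..q} u)"
      unfolding y_q by (intro order_trans[OF norm_triangle_ineq]) (simp add: distrib_left)
    then show "u q \<le> C + \<delta> * N * integral {s..q} u"
      by (simp add: u_def exp_minus field_simps)
  qed (use N \<delta> st cont_u in auto)
  \<comment> \<open>Removing the weight \<open>exp (\<beta> * t)\<close> combines the decay rate
    \<beta> with the Gronwall growth rate \<open>\<delta> * N\<close>.\<close>
  then show ?thesis
    by (simp add: u_def C_def algebra_simps exp_diff exp_add exp_minus field_simps)
qed

end

section \<open>Conformable derivatives as ordinary derivatives\<close>

lemma has_vector_derivative_iff_quotient:
  "(f has_vector_derivative d) (at x) \<longleftrightarrow> ((\<lambda>h. (f (x + h) - f x) /\<^sub>R h) \<longlongrightarrow> d) (at 0)"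
proof -
  have "norm (f (x + h) - f x - h *\<^sub>R d) / norm h = norm ((f (x + h) - f x) /\<^sub>R h - d)" if "h \<noteq> 0" for h
  proof -
    have "f (x + h) - f x - h *\<^sub>R d = h *\<^sub>R ((f (x + h) - f x) /\<^sub>R h - d)"
      using that by (simp add: algebra_simps)
    then show ?thesis using that by simp
  qed
  then have "((\<lambda>h. norm (f (x + h) - f x - h *\<^sub>R d) / norm h) \<longlongrightarrow> 0) (at 0) \<longleftrightarrow>
      ((\<lambda>h. norm ((f (x + h) - f x) /\<^sub>R h - d)) \<longlongrightarrow> 0) (at 0)"
    by (intro Lim_cong_within) auto
  then show ?thesis
    unfolding has_vector_derivative_def has_derivative_at
    by (simp add: bounded_linear_scaleR_left tendsto_norm_zero_iff LIM_zero_iff)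
qed

text \<open>For fixed \<open>t\<close> the increment is a nonzero multiple \<open>e * m\<close> of
  e, so the chain rule applies to this affine substitution and to its inverse.\<close>

lemma has_conformable_derivative_nz_iff:
  assumes t: "t > 0"
  shows "has_conformable_derivative_nz \<alpha> {0..} g d t \<longleftrightarrow>
    (g has_vector_derivative t powr (\<alpha> - 1) *\<^sub>R d) (at t)"
proof -
  define m where "m = t powr (1 - \<alpha>)"
  have m: "m > 0" and inv_m: "t powr (\<alpha> - 1) = inverse m"
    using t by (auto simp: m_def simp flip: powr_minus)
  \<comment> \<open>For e above \<open>- (t / m)\<close> the point stays in the half-line, so the
    domain restriction is void near 0.\<close>
  have "at 0 within {e. t + e * m \<in> {0..}} = at 0 within UNIV"
    by (rule at_within_nhd[of _ "{- (t / m)<..}"]) (use t m in \<open>auto simp: field_simps\<close>)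
  then have "has_conformable_derivative_nz \<alpha> {0..} g d t \<longleftrightarrow>
      ((\<lambda>e. g (t + e * m)) has_vector_derivative d) (at 0)"
    using t by (simp add: has_conformable_derivative_nz_def has_vector_derivative_iff_quotient m_def)
  also have "\<dots> \<longleftrightarrow> (g has_vector_derivative inverse m *\<^sub>R d) (at t)"
  proof
    assume *: "((\<lambda>e. g (t + e * m)) has_vector_derivative d) (at 0)"
    have "((\<lambda>r. (r - t) * inverse m) has_vector_derivative inverse m) (at t)"
      by (auto intro!: derivative_eq_intros simp flip: has_real_derivative_iff_has_vector_derivative)
    moreover have "(\<lambda>e. g (t + e * m)) \<circ> (\<lambda>r. (r - t) * inverse m) = g"
      using m by (simp add: fun_eq_iff mult.assoc)
    ultimately show "(g has_vector_derivative inverse m *\<^sub>R d) (at t)"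
      using vector_diff_chain_at[of "\<lambda>r. (r - t) * inverse m" "inverse m" t "\<lambda>e. g (t + e * m)" d] *
      by simp
  next
    assume *: "(g has_vector_derivative inverse m *\<^sub>R d) (at t)"
    have "((\<lambda>e. t + e * m) has_vector_derivative m) (at 0)"
      by (auto intro!: derivative_eq_intros simp flip: has_real_derivative_iff_has_vector_derivative)
    from vector_diff_chain_at[OF this, of g "inverse m *\<^sub>R d"] * m
    show "((\<lambda>e. g (t + e * m)) has_vector_derivative d) (at 0)" by (simp add: o_def)
  qed
  finally show ?thesis by (simp add: inv_m)
qed

section \<open>The change of time and evolution operators in the new time\<close>

text \<open>The antiderivative of \<open>t powr (\<alpha> - 1)\<close> vanishing at 0; this power is
  the factor between the ordinary and the conformable derivative.\<close>

definition conformable_time :: "real \<Rightarrow> real \<Rightarrow> real" where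
  "conformable_time \<alpha> t = t powr \<alpha> / \<alpha>"

definition conformable_time_inv :: "real \<Rightarrow> real \<Rightarrow> real" where
  "conformable_time_inv \<alpha> \<tau> = (\<alpha> * \<tau>) powr (1 / \<alpha>)"

lemma conformable_exp_eq: "conformable_exp \<alpha> c t = exp (c * conformable_time \<alpha> t)"
  by (simp add: conformable_exp_def conformable_time_def)

context
  fixes \<alpha> :: real
  assumes \<alpha>: "\<alpha> > 0"
begin

lemma conformable_time_inverse [simp]:
  "t \<ge> 0 \<Longrightarrow> conformable_time_inv \<alpha> (conformable_time \<alpha> t) = t"
  "\<tau> \<ge> 0 \<Longrightarrow> conformable_time \<alpha> (conformable_time_inv \<alpha> \<tau>) = \<tau>"
  using \<alpha> by (simp_all add: conformable_time_def conformable_time_inv_def powr_powr)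

lemma conformable_time_nonneg [simp]:
  "conformable_time \<alpha> t \<ge> 0" "conformable_time_inv \<alpha> \<tau> \<ge> 0"
  using \<alpha> by (simp_all add: conformable_time_def conformable_time_inv_def)

lemma conformable_time_pos:
  "t > 0 \<Longrightarrow> conformable_time \<alpha> t > 0" "\<tau> > 0 \<Longrightarrow> conformable_time_inv \<alpha> \<tau> > 0"
  using \<alpha> by (simp_all add: conformable_time_def conformable_time_inv_def)

lemma conformable_time_mono:
  "0 \<le> s \<Longrightarrow> s \<le> t \<Longrightarrow> conformable_time \<alpha> s \<le> conformable_time \<alpha> t"
  "0 \<le> \<sigma> \<Longrightarrow> \<sigma> \<le> \<tau> \<Longrightarrow> conformable_time_inv \<alpha> \<sigma> \<le> conformable_time_inv \<alpha> \<tau>"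
  using \<alpha> by (auto simp: conformable_time_def conformable_time_inv_def
      intro!: divide_right_mono powr_mono2 mult_left_mono)

lemma continuous_on_conformable_time:
  "continuous_on {0..} (conformable_time \<alpha>)" "continuous_on {0..} (conformable_time_inv \<alpha>)"
  unfolding conformable_time_def conformable_time_inv_def
  using \<alpha> by (auto intro!: continuous_intros continuous_on_powr')

lemma has_vector_derivative_conformable_time:
  "t > 0 \<Longrightarrow> (conformable_time \<alpha> has_vector_derivative t powr (\<alpha> - 1)) (at t)"
  unfolding conformable_time_def using \<alpha>
  by (auto intro!: derivative_eq_intros simp flip: has_real_derivative_iff_has_vector_derivative
      simp: powr_diff)

lemma has_vector_derivative_conformable_time_inv:
  assumes "\<tau> > 0"
  shows "(conformable_time_inv \<alpha> has_vector_derivative conformable_time_inv \<alpha> \<tau> powr (1 - \<alpha>)) (at \<tau>)"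
proof -
  have "conformable_time_inv \<alpha> \<tau> powr (1 - \<alpha>) = (\<alpha> * \<tau>) powr (1 / \<alpha> - 1)"
    using \<alpha> by (simp add: conformable_time_inv_def powr_powr field_simps)
  moreover have "((\<lambda>\<tau>. (\<alpha> * \<tau>) powr (1 / \<alpha>)) has_real_derivative (\<alpha> * \<tau>) powr (1 / \<alpha> - 1)) (at \<tau>)"
    using \<alpha> assms by (auto intro!: derivative_eq_intros simp: powr_diff)
  ultimately show ?thesis
    unfolding conformable_time_inv_def by (simp flip: has_real_derivative_iff_has_vector_derivative)
qed

text \<open>By the chain rule the derivative \<open>t powr (1 - \<alpha>)\<close> of the inverse
  time change cancels the factor \<open>t powr (\<alpha> - 1)\<close> in the derivative of
  \<open>x\<close>.\<close>

lemma conformable_solution_rescale: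
  fixes A :: "real \<Rightarrow> 'z::real_normed_vector \<Rightarrow>\<^sub>L 'z"
  assumes "conformable_solution \<alpha> A x"
  defines "y \<equiv> x \<circ> conformable_time_inv \<alpha>"
  shows "continuous_on {0..} y"
    and "\<tau> > 0 \<Longrightarrow> (y has_vector_derivative A (conformable_time_inv \<alpha> \<tau>) (y \<tau>)) (at \<tau>)"
proof -
  show "continuous_on {0..} y"
    unfolding y_def using assms(1)
    by (intro continuous_on_compose continuous_on_conformable_time)
       (auto simp: conformable_solution_def intro: continuous_on_subset)
  assume \<tau>: "\<tau> > 0"
  define t where "t = conformable_time_inv \<alpha> \<tau>"
  have t: "t > 0" using \<tau> by (simp add: t_def conformable_time_pos)
  have "(x has_vector_derivative t powr (\<alpha> - 1) *\<^sub>R A t (x t)) (at t)"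
    using assms(1) t by (auto simp: conformable_solution_def has_conformable_derivative_def
        simp flip: has_conformable_derivative_nz_iff)
  from vector_diff_chain_at[OF has_vector_derivative_conformable_time_inv[OF \<tau>] this[unfolded t_def]]
  show "(y has_vector_derivative A (conformable_time_inv \<alpha> \<tau>) (y \<tau>)) (at \<tau>)"
    using t by (simp add: y_def o_def flip: t_def powr_add)
qed

text \<open>For positive times this is the chain rule. At 0 the conformable derivative is the limit
  of \<open>A t (x t)\<close> from the right, which exists by continuity of \<open>A\<close> and
  x.\<close>

lemma conformable_solutionI:
  fixes A :: "real \<Rightarrow> 'z::real_normed_vector \<Rightarrow>\<^sub>L 'z"
  assumes contA: "continuous_on {0..} A" and cont: "continuous_on {0..} y"
    and deriv: "\<And>\<tau>. \<tau> > 0 \<Longrightarrow> (y has_vector_derivative A (conformable_time_inv \<alpha> \<tau>) (y \<tau>)) (at \<tau>)"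
  shows "conformable_solution \<alpha> A (y \<circ> conformable_time \<alpha>)"
proof -
  let ?x = "y \<circ> conformable_time \<alpha>"
  have cont_x: "continuous_on {0..} ?x"
    by (intro continuous_on_compose continuous_on_conformable_time)
       (auto intro: continuous_on_subset[OF cont])
  have nz: "has_conformable_derivative_nz \<alpha> {0..} ?x (A t (?x t)) t" if t: "t > 0" for t
    using vector_diff_chain_at[OF has_vector_derivative_conformable_time[OF t] deriv] t
    by (simp add: has_conformable_derivative_nz_iff conformable_time_pos)
  have "((\<lambda>t. A t (?x t)) \<longlongrightarrow> A 0 (?x 0)) (at 0 within {0..})"
    using contA cont_x by (intro blinfun.tendsto) (auto simp: continuous_on_def)
  moreover have "\<forall>\<^sub>F t in at 0 within {0..}. has_conformable_derivative_nz \<alpha> {0..} ?x (A t (?x t)) t"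
    using nz by (auto simp: eventually_at_filter intro!: always_eventually)
  ultimately show ?thesis
    unfolding conformable_solution_def has_conformable_derivative_def using cont_x nz
    by (auto intro!: exI[of _ "\<lambda>t. A t (?x t)"])
qed

text \<open>Existence forces the formula: for each v the solution through v at time s determines
  \<open>T t s v\<close>. Uniqueness of solutions gives the converse.\<close>

lemma evolution_operator_iff:
  fixes A :: "real \<Rightarrow> 'z::banach \<Rightarrow>\<^sub>L 'z"
  assumes A: "continuous_on {0..} A"
    and pair: "fundamental_pair (\<lambda>\<tau>. A (conformable_time_inv \<alpha> \<tau>)) \<Phi> \<Psi>"
  shows "evolution_operator \<alpha> A T \<longleftrightarrow>
    (\<forall>t\<ge>0. \<forall>s\<ge>0. T t s = \<Phi> (conformable_time \<alpha> t) o\<^sub>L \<Psi> (conformable_time \<alpha> s))"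
proof -
  interpret fundamental_pair "\<lambda>\<tau>. A (conformable_time_inv \<alpha> \<tau>)" \<Phi> \<Psi> by (rule pair)
  show ?thesis
  proof (intro iffI allI impI)
    fix t s :: real
    assume T: "evolution_operator \<alpha> A T" and "t \<ge> 0" "s \<ge> 0"
    show "T t s = \<Phi> (conformable_time \<alpha> t) o\<^sub>L \<Psi> (conformable_time \<alpha> s)"
    proof (rule blinfun_eqI)
      fix v
      let ?y = "\<lambda>\<tau>. \<Phi> \<tau> (\<Psi> (conformable_time \<alpha> s) v)"
      have sol: "conformable_solution \<alpha> A (?y \<circ> conformable_time \<alpha>)"
        by (intro conformable_solutionI A solution)
      show "T t s v = (\<Phi> (conformable_time \<alpha> t) o\<^sub>L \<Psi> (conformable_time \<alpha> s)) v"
        using T[unfolded evolution_operator_def, rule_format, OF sol \<open>t \<ge> 0\<close> \<open>s \<ge> 0\<close>]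
        by (simp add: \<Phi>_\<Psi>_apply)
    qed
  next
    assume T: "\<forall>t\<ge>0. \<forall>s\<ge>0. T t s = \<Phi> (conformable_time \<alpha> t) o\<^sub>L \<Psi> (conformable_time \<alpha> s)"
    show "evolution_operator \<alpha> A T"
      unfolding evolution_operator_def
    proof (intro allI impI)
      fix x and t s :: real
      assume x: "conformable_solution \<alpha> A x" and "t \<ge> 0" "s \<ge> 0"
      then show "x t = T t s (x s)"
        using solution_unique[OF conformable_solution_rescale[OF x],
            of "conformable_time \<alpha> t" "conformable_time \<alpha> s"] T by simp
    qed
  qed
qed

end

section \<open>Stability under the perturbation\<close>

theorem theorem5p1:
  fixes A B :: "real \<Rightarrow> 'z::banach \<Rightarrow>\<^sub>L 'z"
    and T :: "real \<Rightarrow> real \<Rightarrow> 'z \<Rightarrow>\<^sub>L 'z"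
    and \<alpha> N \<beta> \<epsilon> \<delta> \<theta> \<gamma> :: real
  assumes "0 < \<alpha>" and "\<alpha> \<le> 1"
    and "continuous_on {0..} A"
    and "continuous_on {0..} B" and "bounded (B ` {0..})"
    and "evolution_operator \<alpha> A T"
    and "N > 0" and "\<beta> > 0" and "\<epsilon> \<ge> 0"
    and "nonuniform_bound \<alpha> T N \<beta> \<epsilon>"
    and "\<And>t. t \<ge> 0 \<Longrightarrow> norm (B t) \<le> \<delta> / conformable_exp \<alpha> \<epsilon> t"
    and "\<theta> = \<delta> * N / \<beta>" and "\<theta> < 1"
    and "\<gamma> = \<beta> - \<delta> * N / (1 - \<theta>)"
  shows "nonuniformly_asymptotically_stable \<alpha> (\<lambda>t. A t + B t) \<and>
         (\<forall>U. evolution_operator \<alpha> (\<lambda>t. A t + B t) U \<longrightarrow>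
              nonuniform_bound \<alpha> U (N / (1 - \<theta>)) \<gamma> \<epsilon>)"
proof -
  note \<alpha> = \<open>0 < \<alpha>\<close> and contA = \<open>continuous_on {0..} A\<close> and contB = \<open>continuous_on {0..} B\<close>
  let ?\<tau> = "conformable_time \<alpha>" and ?t = "conformable_time_inv \<alpha>"
  note time [simp] = conformable_time_inverse[OF \<alpha>] conformable_time_nonneg[OF \<alpha>]
  have rescale: "continuous_on {0..} (\<lambda>\<tau>. F (?t \<tau>))" if "continuous_on {0..} F" for F :: "real \<Rightarrow> 'z \<Rightarrow>\<^sub>L 'z"
    by (rule continuous_on_compose2[OF that continuous_on_conformable_time(2)[OF \<alpha>]]) auto
  have contAB: "continuous_on {0..} (\<lambda>t. A t + B t)"
    using contA contB by (rule continuous_on_add)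
  obtain \<Phi> \<Psi> where pair: "fundamental_pair (\<lambda>\<tau>. A (?t \<tau>)) \<Phi> \<Psi>"
    using fundamental_pair_exists[OF rescale[OF contA]] .
  obtain \<Phi>' \<Psi>' where pair': "fundamental_pair (\<lambda>\<tau>. A (?t \<tau>) + B (?t \<tau>)) \<Phi>' \<Psi>'"
    using fundamental_pair_exists[OF rescale[OF contAB]] .
  interpret unperturbed: fundamental_pair "\<lambda>\<tau>. A (?t \<tau>)" \<Phi> \<Psi> by (rule pair)
  interpret perturbed: fundamental_pair "\<lambda>\<tau>. A (?t \<tau>) + B (?t \<tau>)" \<Phi>' \<Psi>' by (rule pair')
  have "0 \<le> \<delta> / conformable_exp \<alpha> \<epsilon> 0"
    using norm_ge_zero assms(11)[of 0] by (rule order_trans) simp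
  then have \<delta>: "\<delta> \<ge> 0" by (simp add: conformable_exp_eq zero_le_divide_iff)
  \<comment> \<open>The hypothesis on \<open>T\<close> is read at the original times
    \<open>?t t\<close> and \<open>?t s\<close>, where \<open>conformable_exp\<close> becomes an
    ordinary exponential.\<close>
  have bound: "norm (\<Phi> t o\<^sub>L \<Psi> s) \<le> N * exp (\<beta> * (s - t)) * exp (\<epsilon> * s)" if "0 \<le> s" "s \<le> t" for s t
  proof -
    have "T (?t t) (?t s) = \<Phi> t o\<^sub>L \<Psi> s"
      using assms(6) that unfolding evolution_operator_iff[OF \<alpha> contA pair] by simp
    moreover have "norm (T (?t t) (?t s)) \<le>
        N * (conformable_exp \<alpha> \<beta> (?t s) / conformable_exp \<alpha> \<beta> (?t t)) * conformable_exp \<alpha> \<epsilon> (?t s)"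
      using assms(10) that conformable_time_mono(2)[OF \<alpha>] unfolding nonuniform_bound_def by auto
    ultimately show ?thesis
      using that by (simp add: conformable_exp_eq exp_diff right_diff_distrib)
  qed
  have B_bound: "norm (B (?t t)) \<le> \<delta> * exp (- (\<epsilon> * t))" if "t \<ge> 0" for t
    using assms(11)[of "?t t"] that by (simp add: conformable_exp_eq exp_minus divide_inverse)
  have U_bound: "norm (U t s) \<le> N * exp ((\<beta> - \<delta> * N) * (?\<tau> s - ?\<tau> t)) * exp (\<epsilon> * ?\<tau> s)"
    if U: "evolution_operator \<alpha> (\<lambda>t. A t + B t) U" and st: "0 \<le> s" "s \<le> t" for U s t
  proof (rule norm_blinfun_bound)
    fix v
    \<comment> \<open>The perturbed solution with value \<open>v\<close> at time \<open>s\<close>.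
      It is built from the perturbed pair but estimated through the unperturbed one.\<close>
    let ?y = "\<lambda>\<tau>. \<Phi>' \<tau> (\<Psi>' (?\<tau> s) v)"
    have "(?y has_vector_derivative A (?t \<tau>) (?y \<tau>) + B (?t \<tau>) (?y \<tau>)) (at \<tau>)" if "\<tau> > 0" for \<tau>
      using perturbed.solution(2)[OF that] by (simp add: blinfun.add_left)
    then have "norm (?y (?\<tau> t)) \<le>
        N * exp ((\<beta> - \<delta> * N) * (?\<tau> s - ?\<tau> t)) * exp (\<epsilon> * ?\<tau> s) * norm (?y (?\<tau> s))"
      using \<open>N > 0\<close> st
      by (intro unperturbed.perturbed_solution_bound[OF rescale[OF contB] perturbed.solution(1) _ bound B_bound _ \<delta>]
          conformable_time_mono[OF \<alpha>]) auto
    moreover have "U t s v = ?y (?\<tau> t)"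
      using U st unfolding evolution_operator_iff[OF \<alpha> contAB pair'] by simp
    ultimately show "norm (U t s v) \<le>
        N * exp ((\<beta> - \<delta> * N) * (?\<tau> s - ?\<tau> t)) * exp (\<epsilon> * ?\<tau> s) * norm v"
      by (simp add: perturbed.\<Phi>_\<Psi>_apply)
  qed (use \<open>N > 0\<close> in auto)
  let ?U = "\<lambda>t s. \<Phi>' (?\<tau> t) o\<^sub>L \<Psi>' (?\<tau> s)"
  have "nonuniformly_asymptotically_stable \<alpha> (\<lambda>t. A t + B t)"
    unfolding nonuniformly_asymptotically_stable_def
  proof (rule exI[of _ ?U], rule exI[of _ N], rule exI[of _ "\<beta> - \<delta> * N"], rule exI[of _ \<epsilon>],
      intro conjI)
    show U: "evolution_operator \<alpha> (\<lambda>t. A t + B t) ?U"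
      unfolding evolution_operator_iff[OF \<alpha> contAB pair'] by simp
    \<comment> \<open>The rate is positive precisely because \<theta> < 1.\<close>
    have "\<delta> * N = \<theta> * \<beta>" using assms(8,12) by simp
    then show "\<beta> - \<delta> * N > 0"
      using mult_strict_right_mono[OF assms(13,8)] by simp
    show "nonuniform_bound \<alpha> ?U N (\<beta> - \<delta> * N) \<epsilon>"
      unfolding nonuniform_bound_def
      using U_bound[OF U] by (simp add: conformable_exp_eq exp_diff right_diff_distrib)
  qed (use assms in auto)
  moreover have "nonuniform_bound \<alpha> U (N / (1 - \<theta>)) \<gamma> \<epsilon>"
    if U: "evolution_operator \<alpha> (\<lambda>t. A t + B t) U" for U
    unfolding nonuniform_bound_def
  proof (intro allI impI)
    fix s t :: real assume st: "0 \<le> s \<and> s \<le> t"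
    have \<theta>: "0 \<le> \<theta>" using assms(7,8,12) \<delta> by simp
    \<comment> \<open>Used twice: with \<open>c = N\<close> for the constant, and with
      \<open>c = \<delta> * N\<close> to compare \<gamma> with
      \<open>\<beta> - \<delta> * N\<close>.\<close>
    have le_divide: "c \<le> c / (1 - \<theta>)" if "c \<ge> 0" for c
      using that \<theta> \<open>\<theta> < 1\<close> by (simp add: field_simps mult_left_le)
    have "\<gamma> \<le> \<beta> - \<delta> * N"
      using le_divide[of "\<delta> * N"] \<delta> assms(7,14) by simp
    \<comment> \<open>Since \<open>s \<le> t\<close>, the time difference is nonpositive and
      reverses the comparison of the rates.\<close>
    then have "(\<beta> - \<delta> * N) * (?\<tau> s - ?\<tau> t) \<le> \<gamma> * (?\<tau> s - ?\<tau> t)"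
      using conformable_time_mono(1)[OF \<alpha>] st by (intro mult_right_mono_neg) auto
    then have "N * exp ((\<beta> - \<delta> * N) * (?\<tau> s - ?\<tau> t)) \<le> N / (1 - \<theta>) * exp (\<gamma> * (?\<tau> s - ?\<tau> t))"
      using le_divide[of N] assms(7,13) by (intro mult_mono) auto
    then have "N * exp ((\<beta> - \<delta> * N) * (?\<tau> s - ?\<tau> t)) * exp (\<epsilon> * ?\<tau> s) \<le>
        N / (1 - \<theta>) * exp (\<gamma> * (?\<tau> s - ?\<tau> t)) * exp (\<epsilon> * ?\<tau> s)"
      by (intro mult_right_mono) auto
    with U_bound[OF U] st have "norm (U t s) \<le> N / (1 - \<theta>) * exp (\<gamma> * (?\<tau> s - ?\<tau> t)) * exp (\<epsilon> * ?\<tau> s)"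
      by (meson order_trans)
    then show "norm (U t s) \<le>
        N / (1 - \<theta>) * (conformable_exp \<alpha> \<gamma> s / conformable_exp \<alpha> \<gamma> t) * conformable_exp \<alpha> \<epsilon> s"
      by (simp add: conformable_exp_eq exp_diff right_diff_distrib)
  qed
  ultimately show ?thesis by blast
qed

end
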